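(* Assume the noise condition (N) and the signal condition (S), and assume further that $$\liminf_{n\to\infty}\frac{n\beta^2}{4\sigma^2\log n}>1 .$$ Then the least-squares estimator $$\hat r\in\mathop{\mathrm{argmin}}_{r\in\mathcal R}\sum_{1\le i\ne j\le n}\left(X_{ij}-\mu_{r(i)r(j)}\right)^2$$ satisfies $\inf_{r\in\mathcal R}\mathbb P_r(\hat r=r)\to1$ as $n\to\infty$.
   Context: Write $[n]=\{1,\dots,n\}$ and let $\|\cdot\|$ be the Euclidean norm on $\mathbb R^n$. All model quantities may depend on $n$. Rank space: $\mathcal R=\{r=(r(1),\dots,r(n))\in[n]^n:\ |\sum_{i=1}^n r(i)-\sum_{i=1}^n i|\le c_n\}$, where $c_n$ satisfies $1\le c_n=o(\sqrt n)$. Model: $(\mu_{kl})_{k,l\in[n]}$ is a known real array. For $r\in\mathcal R$, $\mathbb P_r$ is the law of the observations $\{X_{ij}\}_{1\le i\ne j\le n}$, $X_{ij}=\mu_{r(i)r(j)}+Z_{ij}$. (N) Noise condition, with parameter $\sigma>0$: for every $t>0$ and all reals $(v_{ij})_{1\le i\neq j\le n}$ with $\sum_{i\ne j}v_{ij}^2=1$, $\mathbb P(\sum_{1\le i\ne j\le n}v_{ij}Z_{ij}>t)\le\exp(-t^2/(2\sigma^2))$. (S) Signal condition, with parameter $\beta\in\mathbb R$: for all $r,\tilde r\in\mathcal R$, $\sum_{1\le i\ne j\le n}(\mu_{\tilde r(i)\tilde r(j)}-\mu_{r(i)r(j)})^2\ge 2n\beta^2\|\tilde r-r\|^2$. *)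

theory Defs
  imports "HOL-Probability.Probability" "HOL-Library.Landau_Symbols"
begin

text \<open>Ranks are functions on \<open>{1..n}\<close>, made extensional so that equality of functions is
  equality of the vectors \<open>(r(1), \<dots>, r(n))\<close>.\<close>

definition rank_space :: "nat \<Rightarrow> real \<Rightarrow> (nat \<Rightarrow> nat) set" where
  "rank_space n c =
     {r \<in> {1..n} \<rightarrow>\<^sub>E {1..n}. \<bar>(\<Sum>i=1..n. real (r i)) - (\<Sum>i=1..n. real i)\<bar> \<le> c}"

definition offdiag :: "nat \<Rightarrow> (nat \<times> nat) set" where
  "offdiag n = {(i, j). i \<in> {1..n} \<and> j \<in> {1..n} \<and> i \<noteq> j}"

definition obs_space :: "nat \<Rightarrow> (nat \<times> nat \<Rightarrow> real) measure" where
  "obs_space n = Pi\<^sub>M (offdiag n) (\<lambda>_. borel)"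

definition obs_law ::
  "nat \<Rightarrow> (nat \<Rightarrow> nat \<Rightarrow> real) \<Rightarrow> (nat \<Rightarrow> nat) \<Rightarrow> 'a measure \<Rightarrow> (nat \<Rightarrow> nat \<Rightarrow> 'a \<Rightarrow> real)
     \<Rightarrow> (nat \<times> nat \<Rightarrow> real) measure" where
  "obs_law n \<mu> r M Z =
     distr M (obs_space n) (\<lambda>\<omega>. \<lambda>(i, j)\<in>offdiag n. \<mu> (r i) (r j) + Z i j \<omega>)"

definition noise_condition ::
  "nat \<Rightarrow> real \<Rightarrow> 'a measure \<Rightarrow> (nat \<Rightarrow> nat \<Rightarrow> 'a \<Rightarrow> real) \<Rightarrow> bool" where
  "noise_condition n \<sigma> M Z \<longleftrightarrow>
     (\<forall>t>0. \<forall>v :: nat \<Rightarrow> nat \<Rightarrow> real. (\<Sum>(i, j)\<in>offdiag n. (v i j)\<^sup>2) = 1 \<longrightarrow>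
        measure M {\<omega> \<in> space M. (\<Sum>(i, j)\<in>offdiag n. v i j * Z i j \<omega>) > t}
          \<le> exp (- t\<^sup>2 / (2 * \<sigma>\<^sup>2)))"

definition signal_condition ::
  "nat \<Rightarrow> real \<Rightarrow> real \<Rightarrow> (nat \<Rightarrow> nat \<Rightarrow> real) \<Rightarrow> bool" where
  "signal_condition n c \<beta> \<mu> \<longleftrightarrow>
     (\<forall>r\<in>rank_space n c. \<forall>r'\<in>rank_space n c.
        (\<Sum>(i, j)\<in>offdiag n. (\<mu> (r' i) (r' j) - \<mu> (r i) (r j))\<^sup>2)
          \<ge> 2 * real n * \<beta>\<^sup>2 * (L2_set (\<lambda>i. real (r' i) - real (r i)) {1..n})\<^sup>2)"

definition sq_loss ::
  "nat \<Rightarrow> (nat \<Rightarrow> nat \<Rightarrow> real) \<Rightarrow> (nat \<times> nat \<Rightarrow> real) \<Rightarrow> (nat \<Rightarrow> nat) \<Rightarrow> real" where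
  "sq_loss n \<mu> x r = (\<Sum>(i, j)\<in>offdiag n. (x (i, j) - \<mu> (r i) (r j))\<^sup>2)"

text \<open>The minimiser need not be unique; any selection of one, measurable in the data, is a
  least-squares estimator. Measurability makes the event that the estimator equals \<open>r\<close> have
  a probability.\<close>

definition least_squares_estimator ::
  "nat \<Rightarrow> real \<Rightarrow> (nat \<Rightarrow> nat \<Rightarrow> real) \<Rightarrow> ((nat \<times> nat \<Rightarrow> real) \<Rightarrow> (nat \<Rightarrow> nat)) \<Rightarrow> bool" where
  "least_squares_estimator n c \<mu> rhat \<longleftrightarrow>
     rhat \<in> measurable (obs_space n) (count_space (rank_space n c)) \<and>
     (\<forall>x\<in>space (obs_space n). is_arg_min (sq_loss n \<mu> x) (\<lambda>r. r \<in> rank_space n c) (rhat x))"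

end

theory Submission
  imports Defs "HOL-Real_Asymp.Real_Asymp"
begin

text \<open>
  If the least-squares estimator misses the true rank \<open>r\<close>, then some \<open>r' \<noteq> r\<close> has a loss no larger
  than that of \<open>r\<close>. Put \<open>d = \<mu>(r') - \<mu>(r)\<close>, the difference of the two mean arrays, and let \<open>D\<close> be
  its Euclidean norm. Expanding the squares, the event says that the
  noise has inner product at least \<open>D\<^sup>2 / 2\<close> with \<open>d\<close>, which has probability at most
  \<open>exp (-D\<^sup>2 / (8 \<sigma>\<^sup>2))\<close> by (N) (lemma \<open>pairwise_error\<close>). By (S) this is at most
  \<open>q\<close> to the power \<open>\<parallel>r' - r\<parallel>\<^sup>2\<close>, where \<open>q = exp (-n \<beta>\<^sup>2 / (4 \<sigma>\<^sup>2))\<close>.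

  The union bound needs no count of the ranks at a given distance: as \<open>\<parallel>r' - r\<parallel>\<^sup>2\<close>
  is a sum over coordinates, the sum of these bounds over all of \<open>[n]\<^sup>n\<close>, a set containing
  the rank space, factorises into
  \<open>n\<close> theta-like sums, each at most \<open>1 + 4 q\<close> when \<open>q \<le> 1/2\<close>. Hence the error probability is at
  most \<open>(1 + 4 q)\<^sup>n - 1 \<le> exp (4 n q) - 1\<close>, uniformly in \<open>r\<close> (lemma \<open>recovery_prob_ge\<close>), and the
  assumption on the lower limit gives \<open>q \<le> n\<^sup>-\<^sup>\<delta>\<close> eventually for some \<open>\<delta> > 1\<close>, so that \<open>n q \<rightarrow> 0\<close>.
\<close>

section \<open>The rank space and the off-diagonal index set\<close>

lemma finite_offdiag [simp]: "finite (offdiag n)"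
  by (rule finite_subset[of _ "{1..n} \<times> {1..n}"]) (auto simp: offdiag_def)

lemma finite_rank_space [simp]: "finite (rank_space n c)"
  unfolding rank_space_def by (rule finite_subset[OF _ finite_PiE[of "{1..n}" "\<lambda>_. {1..n}"]]) auto

lemma identity_in_rank_space:
  assumes "0 \<le> c"
  shows "restrict id {1..n} \<in> rank_space n c"
  using assms by (auto simp: rank_space_def)

section \<open>Comparing the losses of two ranks\<close>

text \<open>The noise condition bounds the probability of exceeding \<open>t\<close>; left continuity of the bound
  extends it to the probability of reaching \<open>t\<close>, as is needed for ties in the loss.\<close>

lemma noise_condition_ge:
  assumes N: "noise_condition n \<sigma> M Z" and "finite_measure M"
    and meas: "\<And>i j. (i, j) \<in> offdiag n \<Longrightarrow> Z i j \<in> borel_measurable M"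
    and \<sigma>: "\<sigma> > 0" and t: "t > 0"
    and v: "(\<Sum>(i, j)\<in>offdiag n. (v i j)\<^sup>2) = (1::real)"
  shows "measure M {\<omega> \<in> space M. (\<Sum>(i, j)\<in>offdiag n. v i j * Z i j \<omega>) \<ge> t}
           \<le> exp (- t\<^sup>2 / (2 * \<sigma>\<^sup>2))"
proof (rule tendsto_lowerbound)
  interpret finite_measure M by fact
  have [measurable]: "(\<lambda>\<omega>. \<Sum>(i, j)\<in>offdiag n. v i j * Z i j \<omega>) \<in> borel_measurable M"
    using meas by (auto intro!: borel_measurable_sum simp: case_prod_beta)
  show "((\<lambda>s. exp (- s\<^sup>2 / (2 * \<sigma>\<^sup>2))) \<longlongrightarrow> exp (- t\<^sup>2 / (2 * \<sigma>\<^sup>2))) (at_left t)"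
    using \<sigma> by (intro tendsto_intros) auto
  have "\<forall>\<^sub>F s in at_left t. s \<in> {0<..<t}"
    using t by (rule eventually_at_left_real)
  then show "\<forall>\<^sub>F s in at_left t.
      measure M {\<omega> \<in> space M. (\<Sum>(i, j)\<in>offdiag n. v i j * Z i j \<omega>) \<ge> t} \<le> exp (- s\<^sup>2 / (2 * \<sigma>\<^sup>2))"
  proof eventually_elim
    case (elim s)
    have "measure M {\<omega> \<in> space M. (\<Sum>(i, j)\<in>offdiag n. v i j * Z i j \<omega>) \<ge> t}
        \<le> measure M {\<omega> \<in> space M. (\<Sum>(i, j)\<in>offdiag n. v i j * Z i j \<omega>) > s}"
      using elim by (intro finite_measure_mono) auto
    also have "\<dots> \<le> exp (- s\<^sup>2 / (2 * \<sigma>\<^sup>2))"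
      using N elim v unfolding noise_condition_def by auto
    finally show ?case .
  qed
qed auto

lemma obs_measurable:
  assumes "\<And>i j. (i, j) \<in> offdiag n \<Longrightarrow> Z i j \<in> borel_measurable M"
  shows "(\<lambda>\<omega>. \<lambda>(i, j)\<in>offdiag n. \<mu> (r i) (r j) + Z i j \<omega>) \<in> measurable M (obs_space n)"
  unfolding obs_space_def using assms by (intro measurable_restrict) auto

lemma sq_loss_measurable [measurable]:
  "(\<lambda>x. sq_loss n \<mu> x r) \<in> borel_measurable (obs_space n)"
  unfolding sq_loss_def obs_space_def
  by (intro borel_measurable_sum)
    (auto simp: case_prod_beta intro!: borel_measurable_power borel_measurable_diff)

lemma pairwise_error:
  fixes \<mu> :: "nat \<Rightarrow> nat \<Rightarrow> real" and n :: nat and r r' :: "nat \<Rightarrow> nat"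
    and Z :: "nat \<Rightarrow> nat \<Rightarrow> 'a \<Rightarrow> real"
  defines "X \<equiv> \<lambda>\<omega>. \<lambda>(i, j)\<in>offdiag n. \<mu> (r i) (r j) + Z i j \<omega>"
  defines "S \<equiv> \<Sum>(i, j)\<in>offdiag n. (\<mu> (r' i) (r' j) - \<mu> (r i) (r j))\<^sup>2"
  assumes N: "noise_condition n \<sigma> M Z" and M: "finite_measure M"
    and meas: "\<And>i j. (i, j) \<in> offdiag n \<Longrightarrow> Z i j \<in> borel_measurable M"
    and \<sigma>: "\<sigma> > 0" and S: "S > 0"
  shows "measure M {\<omega> \<in> space M. sq_loss n \<mu> (X \<omega>) r' \<le> sq_loss n \<mu> (X \<omega>) r}
           \<le> exp (- S / (8 * \<sigma>\<^sup>2))"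
proof -
  define D where "D = sqrt (S)"
  have D: "D > 0" "D\<^sup>2 = S" using S by (auto simp: D_def)
  define d where "d = (\<lambda>i j. \<mu> (r' i) (r' j) - \<mu> (r i) (r j))"
  define v where "v = (\<lambda>i j. d i j / D)"
  have v: "(\<Sum>(i, j)\<in>offdiag n. (v i j)\<^sup>2) = 1"
  proof -
    have "(\<Sum>(i, j)\<in>offdiag n. (v i j)\<^sup>2) = S / D\<^sup>2"
      unfolding v_def S_def d_def
      by (simp add: sum_divide_distrib power_divide case_prod_beta)
    then show ?thesis using D S by simp
  qed
  have iff: "sq_loss n \<mu> (X \<omega>) r' \<le> sq_loss n \<mu> (X \<omega>) r
      \<longleftrightarrow> (\<Sum>(i, j)\<in>offdiag n. v i j * Z i j \<omega>) \<ge> D / 2" for \<omega>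
  proof -
    have "sq_loss n \<mu> (X \<omega>) r' - sq_loss n \<mu> (X \<omega>) r
        = (\<Sum>(i, j)\<in>offdiag n. (d i j)\<^sup>2 - 2 * D * (v i j * Z i j \<omega>))"
      unfolding sq_loss_def X_def sum_subtractf[symmetric] using D(1)
      by (intro sum.cong) (auto simp: d_def v_def power2_eq_square field_simps)
    also have "\<dots> = S - 2 * D * (\<Sum>(i, j)\<in>offdiag n. v i j * Z i j \<omega>)"
      unfolding S_def d_def by (simp add: case_prod_beta sum_subtractf sum_distrib_left)
    also have "\<dots> = 2 * D * (D / 2 - (\<Sum>(i, j)\<in>offdiag n. v i j * Z i j \<omega>))"
      by (simp add: D(2)[symmetric] power2_eq_square algebra_simps)
    finally have "sq_loss n \<mu> (X \<omega>) r' \<le> sq_loss n \<mu> (X \<omega>) r \<longleftrightarrow>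
        2 * D * (D / 2 - (\<Sum>(i, j)\<in>offdiag n. v i j * Z i j \<omega>)) \<le> 0" by linarith
    then show ?thesis using D(1) by (simp add: mult_le_0_iff)
  qed
  have "measure M {\<omega> \<in> space M. sq_loss n \<mu> (X \<omega>) r' \<le> sq_loss n \<mu> (X \<omega>) r}
      \<le> exp (- (D / 2)\<^sup>2 / (2 * \<sigma>\<^sup>2))"
    unfolding iff using D by (intro noise_condition_ge[OF N M meas \<sigma> _ v]) auto
  also have "- (D / 2)\<^sup>2 / (2 * \<sigma>\<^sup>2) = - S / (8 * \<sigma>\<^sup>2)"
    by (simp add: power_divide D(2))
  finally show ?thesis .
qed

section \<open>Summing the pairwise bounds over all vectors\<close>

lemma sum_geometric_le:
  fixes q :: real
  assumes "0 \<le> q" "q \<le> 1 / 2"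
  shows "(\<Sum>k=1..m. q ^ k) \<le> 2 * q"
proof -
  have "(\<Sum>k<m. q ^ k) \<le> (\<Sum>k. q ^ k)"
    using assms by (intro sum_le_suminf summable_geometric) auto
  also have "(\<Sum>k. q ^ k) = 1 / (1 - q)"
    using assms by (intro suminf_geometric) auto
  also have "1 / (1 - q) \<le> 2"
    using assms by (simp add: divide_simps)
  finally have "q * (\<Sum>k<m. q ^ k) \<le> q * 2"
    using assms(1) by (rule mult_left_mono)
  also have "q * (\<Sum>k<m. q ^ k) = (\<Sum>k=1..m. q ^ k)"
    unfolding sum_distrib_left
    by (rule sum.reindex_bij_witness[of _ "\<lambda>k. k - 1" Suc]) (auto simp flip: power_Suc)
  finally show ?thesis by simp
qed

text \<open>Since \<open>m\<^sup>2 \<ge> \<bar>m\<bar>\<close> for integers, the sum is dominated by two geometric series around \<open>a\<close>.\<close>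

lemma theta_sum_le:
  fixes q :: real
  assumes q: "0 \<le> q" "q \<le> 1 / 2"
  shows "(\<Sum>k=1..n. q ^ nat ((int k - int a)\<^sup>2)) \<le> 1 + 4 * q"
proof -
  let ?f = "\<lambda>k. q ^ nat ((int k - int a)\<^sup>2)"
  have sq: "nat \<bar>x\<bar> \<le> nat (x\<^sup>2)" for x :: int
  proof (cases "x = 0")
    case False
    then have "\<bar>x\<bar> * 1 \<le> \<bar>x\<bar> * \<bar>x\<bar>" by (intro mult_left_mono) auto
    then show ?thesis by (simp add: power2_eq_square)
  qed simp
  have le: "?f k \<le> q ^ nat \<bar>int k - int a\<bar>" for k
    using q by (intro power_decreasing sq) auto
  have "(\<Sum>k=1..n. ?f k) \<le> (\<Sum>k\<in>{a} \<union> {..<a} \<union> {a<..a+n}. ?f k)"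
    using q by (intro sum_mono2) auto
  also have "\<dots> = 1 + (\<Sum>k\<in>{..<a}. ?f k) + (\<Sum>k\<in>{a<..a+n}. ?f k)"
    by (subst sum.union_disjoint, simp, simp, force)+ simp
  also have "(\<Sum>k\<in>{..<a}. ?f k) \<le> (\<Sum>k\<in>{..<a}. q ^ nat \<bar>int k - int a\<bar>)"
    by (intro sum_mono le)
  also have "\<dots> = (\<Sum>k=1..a. q ^ k)"
    by (rule sum.reindex_bij_witness[of _ "\<lambda>k. a - k" "\<lambda>k. a - k"]) (auto simp: nat_diff_distrib)
  also have "\<dots> \<le> 2 * q" by (rule sum_geometric_le[OF q])
  also have "(\<Sum>k\<in>{a<..a+n}. ?f k) \<le> (\<Sum>k\<in>{a<..a+n}. q ^ nat \<bar>int k - int a\<bar>)"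
    by (intro sum_mono le)
  also have "\<dots> = (\<Sum>k=1..n. q ^ k)"
    by (rule sum.reindex_bij_witness[of _ "\<lambda>k. a + k" "\<lambda>k. k - a"]) (auto simp: nat_diff_distrib)
  also have "\<dots> \<le> 2 * q" by (rule sum_geometric_le[OF q])
  finally show ?thesis by simp
qed

text \<open>The sum over \<open>[n]\<^sup>n\<close> of \<open>q\<close> to the squared distance from \<open>r\<close> is a product over coordinates.\<close>

lemma sum_exp_sq_dist_le:
  fixes a :: real
  assumes "exp (- a) \<le> 1 / 2"
  shows "(\<Sum>r'\<in>{1..n} \<rightarrow>\<^sub>E {1..n}. exp (- a * (L2_set (\<lambda>i. real (r' i) - real (r i)) {1..n})\<^sup>2))
           \<le> exp (4 * (real n * exp (- a)))"
proof -
  define q where "q = exp (- a)"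
  have q: "0 \<le> q" "q \<le> 1 / 2" using assms by (auto simp: q_def)
  have pow: "exp (- a * (real x - real y)\<^sup>2) = q ^ nat ((int x - int y)\<^sup>2)" for x y :: nat
  proof -
    have "(real x - real y)\<^sup>2 = real (nat ((int x - int y)\<^sup>2))" by simp
    then show ?thesis by (simp add: q_def exp_of_nat_mult[symmetric] mult.commute)
  qed
  have "exp (- a * (L2_set (\<lambda>i. real (r' i) - real (r i)) {1..n})\<^sup>2)
      = (\<Prod>i=1..n. q ^ nat ((int (r' i) - int (r i))\<^sup>2))" for r'
    unfolding L2_set_def
    by (simp add: sum_nonneg pow[symmetric] exp_sum[symmetric] sum_distrib_left sum_negf)
  then have "(\<Sum>r'\<in>{1..n} \<rightarrow>\<^sub>E {1..n}. exp (- a * (L2_set (\<lambda>i. real (r' i) - real (r i)) {1..n})\<^sup>2))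
      = (\<Sum>r'\<in>{1..n} \<rightarrow>\<^sub>E {1..n}. \<Prod>i=1..n. q ^ nat ((int (r' i) - int (r i))\<^sup>2))"
    by (intro sum.cong) auto
  also have "\<dots> = (\<Prod>i=1..n. \<Sum>k=1..n. q ^ nat ((int k - int (r i))\<^sup>2))"
    by (rule prod_sum_PiE[symmetric]) auto
  also have "\<dots> \<le> (\<Prod>i=1..n. exp (4 * q))"
  proof (rule prod_mono, intro conjI)
    fix i
    show "0 \<le> (\<Sum>k=1..n. q ^ nat ((int k - int (r i))\<^sup>2))"
      using q by (intro sum_nonneg) auto
    show "(\<Sum>k=1..n. q ^ nat ((int k - int (r i))\<^sup>2)) \<le> exp (4 * q)"
      using theta_sum_le[OF q, of "r i" n] exp_ge_add_one_self[of "4 * q"] by linarith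
  qed
  also have "\<dots> = exp (4 * (real n * exp (- a)))"
    by (simp add: exp_of_nat_mult[symmetric] q_def algebra_simps)
  finally show ?thesis .
qed

section \<open>Exact recovery\<close>

text \<open>Recovery bound for a fixed \<open>n\<close>, uniform in \<open>r\<close>. The constant is \<open>2\<close> because the sum over all
  of \<open>[n]\<^sup>n\<close> includes the term \<open>r' = r\<close>, which equals \<open>1\<close> and bounds no error event: the error
  probability is at most that sum minus \<open>1\<close>.\<close>

lemma recovery_prob_ge:
  fixes \<mu> :: "nat \<Rightarrow> nat \<Rightarrow> real" and n :: nat and \<beta> \<sigma> :: real
  defines "a \<equiv> real n * \<beta>\<^sup>2 / (4 * \<sigma>\<^sup>2)"
  assumes "prob_space M"
    and meas: "\<And>i j. (i, j) \<in> offdiag n \<Longrightarrow> Z i j \<in> borel_measurable M"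
    and N: "noise_condition n \<sigma> M Z" and \<sigma>: "\<sigma> > 0"
    and signal: "signal_condition n c \<beta> \<mu>"
    and lse: "least_squares_estimator n c \<mu> rhat"
    and r: "r \<in> rank_space n c"
    and a: "exp (- a) \<le> 1 / 2"
  shows "measure (obs_law n \<mu> r M Z) {x \<in> space (obs_space n). rhat x = r}
           \<ge> 2 - exp (4 * (real n * exp (- a)))"
proof -
  interpret prob_space M by fact
  define X where "X = (\<lambda>\<omega>. \<lambda>(i, j)\<in>offdiag n. \<mu> (r i) (r j) + Z i j \<omega>)"
  have X [measurable]: "X \<in> measurable M (obs_space n)"
    unfolding X_def by (rule obs_measurable[OF meas])
  have rhat [measurable]: "rhat \<in> measurable (obs_space n) (count_space (rank_space n c))"
    using lse by (auto simp: least_squares_estimator_def)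
  define R where "R = rank_space n c - {r}"
  define E where "E = (\<lambda>r'. {\<omega> \<in> space M. sq_loss n \<mu> (X \<omega>) r' \<le> sq_loss n \<mu> (X \<omega>) r})"
  define w where "w = (\<lambda>r'. exp (- a * (L2_set (\<lambda>i. real (r' i) - real (r i)) {1..n})\<^sup>2))"
  have E_sets: "E r' \<in> sets M" for r'
    unfolding E_def by measurable
  have a_pos: "a > 0" using a exp_ge_add_one_self[of "- a"] by linarith
  have E_le: "prob (E r') \<le> w r'" if r': "r' \<in> R" for r'
  proof -
    let ?S = "\<Sum>(i, j)\<in>offdiag n. (\<mu> (r' i) (r' j) - \<mu> (r i) (r j))\<^sup>2"
    let ?L = "(L2_set (\<lambda>i. real (r' i) - real (r i)) {1..n})\<^sup>2"
    have "r' \<noteq> r" "r' \<in> {1..n} \<rightarrow>\<^sub>E {1..n}" "r \<in> {1..n} \<rightarrow>\<^sub>E {1..n}"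
      using r r' by (auto simp: R_def rank_space_def)
    then obtain i where i: "i \<in> {1..n}" "r' i \<noteq> r i" by (meson PiE_ext)
    have "L2_set (\<lambda>i. real (r' i) - real (r i)) {1..n} \<noteq> 0"
      using i by (subst L2_set_eq_0_iff) auto
    then have L: "?L > 0" by simp
    have S: "2 * real n * \<beta>\<^sup>2 * ?L \<le> ?S"
      using signal r r' by (auto simp: signal_condition_def R_def)
    have "real n * \<beta>\<^sup>2 > 0"
      using a_pos \<sigma> by (simp add: a_def zero_less_divide_iff)
    with L have "2 * real n * \<beta>\<^sup>2 * ?L > 0" by simp
    with S have "?S > 0" by linarith
    then have "prob (E r') \<le> exp (- ?S / (8 * \<sigma>\<^sup>2))"
      unfolding E_def X_def
      by (intro pairwise_error[OF N finite_measure_axioms meas \<sigma>])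
    also have "?S / (8 * \<sigma>\<^sup>2) \<ge> 2 * real n * \<beta>\<^sup>2 * ?L / (8 * \<sigma>\<^sup>2)"
      using S \<sigma> by (intro divide_right_mono) auto
    then have "exp (- ?S / (8 * \<sigma>\<^sup>2)) \<le> w r'"
      by (simp add: w_def a_def)
    finally show ?thesis .
  qed
  define G where "G = {\<omega> \<in> space M. rhat (X \<omega>) = r}"
  have G_sets: "G \<in> sets M"
    unfolding G_def using r by measurable
  have eq: "measure (obs_law n \<mu> r M Z) {x \<in> space (obs_space n). rhat x = r} = prob G"
  proof -
    have "{x \<in> space (obs_space n). rhat x = r} \<in> sets (obs_space n)"
      using r by measurable
    then have "measure (obs_law n \<mu> r M Z) {x \<in> space (obs_space n). rhat x = r}
        = prob (X -` {x \<in> space (obs_space n). rhat x = r} \<inter> space M)"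
      unfolding obs_law_def X_def[symmetric] by (intro measure_distr X)
    also have "X -` {x \<in> space (obs_space n). rhat x = r} \<inter> space M = G"
      using measurable_space[OF X] by (auto simp: G_def)
    finally show ?thesis .
  qed
  have "space M - G \<subseteq> (\<Union>r'\<in>R. E r')"
  proof
    fix \<omega> assume \<omega>: "\<omega> \<in> space M - G"
    then have "X \<omega> \<in> space (obs_space n)" using measurable_space[OF X] by auto
    then have min: "is_arg_min (sq_loss n \<mu> (X \<omega>)) (\<lambda>r. r \<in> rank_space n c) (rhat (X \<omega>))"
      using lse by (auto simp: least_squares_estimator_def)
    then have "sq_loss n \<mu> (X \<omega>) (rhat (X \<omega>)) \<le> sq_loss n \<mu> (X \<omega>) r"
      using r by (auto simp: is_arg_min_linorder)
    with min \<omega> show "\<omega> \<in> (\<Union>r'\<in>R. E r')"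
      by (auto simp: is_arg_min_linorder R_def E_def G_def)
  qed
  then have "prob (space M - G) \<le> prob (\<Union>r'\<in>R. E r')"
    using E_sets by (intro finite_measure_mono) (auto simp: R_def)
  also have "\<dots> \<le> (\<Sum>r'\<in>R. prob (E r'))"
    using E_sets by (intro finite_measure_subadditive_finite) (auto simp: R_def)
  also have "\<dots> \<le> (\<Sum>r'\<in>R. w r')" by (intro sum_mono E_le)
  also have "\<dots> = (\<Sum>r'\<in>rank_space n c. w r') - 1"
    using r by (simp add: R_def sum_diff1 w_def L2_set_def)
  also have "(\<Sum>r'\<in>rank_space n c. w r') \<le> (\<Sum>r'\<in>{1..n} \<rightarrow>\<^sub>E {1..n}. w r')"
    by (intro sum_mono2) (auto simp: rank_space_def w_def intro!: finite_PiE)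
  also have "\<dots> \<le> exp (4 * (real n * exp (- a)))"
    unfolding w_def by (rule sum_exp_sq_dist_le[OF a])
  finally have "prob (space M - G) \<le> exp (4 * (real n * exp (- a))) - 1" by simp
  then show ?thesis unfolding eq prob_compl[OF G_sets] by linarith
qed

theorem theorem2p4:
  fixes c \<sigma> \<beta> :: "nat \<Rightarrow> real"
    and \<mu> :: "nat \<Rightarrow> nat \<Rightarrow> nat \<Rightarrow> real"
    and M :: "nat \<Rightarrow> (nat \<Rightarrow> nat) \<Rightarrow> 'a measure"
    and Z :: "nat \<Rightarrow> (nat \<Rightarrow> nat) \<Rightarrow> nat \<Rightarrow> nat \<Rightarrow> 'a \<Rightarrow> real"
    and rhat :: "nat \<Rightarrow> (nat \<times> nat \<Rightarrow> real) \<Rightarrow> (nat \<Rightarrow> nat)"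
  assumes "\<And>n. n \<ge> 1 \<Longrightarrow> 1 \<le> c n"
    and "c \<in> o(\<lambda>n. sqrt (real n))"
    and "\<And>n. n \<ge> 1 \<Longrightarrow> \<sigma> n > 0"
    and "\<And>n r. n \<ge> 1 \<Longrightarrow> r \<in> rank_space n (c n) \<Longrightarrow> prob_space (M n r)"
    and "\<And>n r i j. n \<ge> 1 \<Longrightarrow> r \<in> rank_space n (c n) \<Longrightarrow> (i, j) \<in> offdiag n \<Longrightarrow>
           Z n r i j \<in> borel_measurable (M n r)"
    and "\<And>n r. n \<ge> 1 \<Longrightarrow> r \<in> rank_space n (c n) \<Longrightarrow> noise_condition n (\<sigma> n) (M n r) (Z n r)"
    and "\<And>n. n \<ge> 1 \<Longrightarrow> signal_condition n (c n) (\<beta> n) (\<mu> n)"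
    and "Liminf sequentially
           (\<lambda>n. ereal (real n * (\<beta> n)\<^sup>2 / (4 * (\<sigma> n)\<^sup>2 * ln (real n)))) > 1"
    and "\<And>n. n \<ge> 1 \<Longrightarrow> least_squares_estimator n (c n) (\<mu> n) (rhat n)"
  shows "(\<lambda>n. INF r\<in>rank_space n (c n).
            measure (obs_law n (\<mu> n) r (M n r) (Z n r)) {x \<in> space (obs_space n). rhat n x = r})
          \<longlonglongrightarrow> 1"
proof -
  define a where "a = (\<lambda>n. real n * (\<beta> n)\<^sup>2 / (4 * (\<sigma> n)\<^sup>2))"
  define P where "P = (\<lambda>n r. measure (obs_law n (\<mu> n) r (M n r) (Z n r))
                          {x \<in> space (obs_space n). rhat n x = r})"
  obtain \<delta> where "ereal 1 < ereal \<delta>"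
    and \<delta>: "ereal \<delta> < Liminf sequentially
           (\<lambda>n. ereal (real n * (\<beta> n)\<^sup>2 / (4 * (\<sigma> n)\<^sup>2 * ln (real n))))"
    using ereal_dense2[of "ereal 1"] assms(8) by (auto simp: one_ereal_def)
  then have \<delta>1: "\<delta> > 1" by simp
  have "\<forall>\<^sub>F n in sequentially. \<delta> * ln (real n) \<le> a n"
    using less_LiminfD[OF \<delta>] eventually_gt_at_top[of 1]
  proof eventually_elim
    case (elim n)
    then have "\<delta> < a n / ln (real n)" by (simp add: a_def)
    moreover have "ln (real n) > 0" using elim by simp
    ultimately show ?case by (simp add: pos_less_divide_eq)
  qed
  then have q_le: "\<forall>\<^sub>F n in sequentially. exp (- a n) \<le> real n powr (- \<delta>)"
    using eventually_gt_at_top[of 0] by eventually_elim (simp add: powr_def)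
  have nq: "(\<lambda>n. real n * exp (- a n)) \<longlonglongrightarrow> 0"
  proof (rule tendsto_sandwich[of "\<lambda>_. 0"])
    show "\<forall>\<^sub>F n in sequentially. real n * exp (- a n) \<le> real n * real n powr (- \<delta>)"
      using q_le by eventually_elim (auto intro: mult_left_mono)
    show "(\<lambda>n. real n * real n powr (- \<delta>)) \<longlonglongrightarrow> 0"
      using \<delta>1 by real_asymp
  qed auto
  have "(\<lambda>n. real n powr (- \<delta>)) \<longlonglongrightarrow> 0" using \<delta>1 by real_asymp
  then have "\<forall>\<^sub>F n in sequentially. real n powr (- \<delta>) < 1 / 2"
    by (rule order_tendstoD) auto
  then have half: "\<forall>\<^sub>F n in sequentially. exp (- a n) \<le> 1 / 2"
    using q_le by eventually_elim linarith
  have "(\<lambda>n. INF r\<in>rank_space n (c n). P n r) \<longlonglongrightarrow> 1"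
  proof (rule tendsto_sandwich)
    have "(\<lambda>n. 2 - exp (4 * (real n * exp (- a n)))) \<longlonglongrightarrow> 2 - exp (4 * 0)"
      by (intro tendsto_intros nq)
    then show "(\<lambda>n. 2 - exp (4 * (real n * exp (- a n)))) \<longlonglongrightarrow> 1" by simp
    show "\<forall>\<^sub>F n in sequentially.
        2 - exp (4 * (real n * exp (- a n))) \<le> (INF r\<in>rank_space n (c n). P n r)"
      using half eventually_ge_at_top[of 1]
    proof eventually_elim
      case (elim n)
      have "restrict id {1..n} \<in> rank_space n (c n)"
        using assms(1)[of n] elim by (intro identity_in_rank_space) auto
      then show ?case
        using elim assms(3-7,9) unfolding P_def a_def
        by (intro cINF_greatest recovery_prob_ge) auto
    qed
    show "\<forall>\<^sub>F n in sequentially. (INF r\<in>rank_space n (c n). P n r) \<le> 1"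
      using eventually_ge_at_top[of 1]
    proof eventually_elim
      case (elim n)
      define r :: "nat \<Rightarrow> nat" where "r = restrict id {1..n}"
      have r: "r \<in> rank_space n (c n)"
        using assms(1)[of n] elim unfolding r_def by (intro identity_in_rank_space) auto
      have "(INF r\<in>rank_space n (c n). P n r) \<le> P n r"
        by (rule cINF_lower[OF _ r]) (auto simp: P_def)
      moreover have "prob_space (obs_law n (\<mu> n) r (M n r) (Z n r))"
        unfolding obs_law_def using assms(4,5) elim r
        by (intro prob_space.prob_space_distr obs_measurable) auto
      ultimately show ?case
        using prob_space.prob_le_1 unfolding P_def by (meson order_trans)
    qed
  qed auto
  then show ?thesis unfolding P_def .
qed

end
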